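(* For every nonnegative integer $n$, let $r_F(n)$ be the number of ways to write $n$ as a sum of distinct Fibonacci numbers, where the order of the summands does not matter. For all positive integers $p$ and $N$, let \[ S_F^{(p)}(N) := \sum_{n=0}^{N-1} \big(r_F(n)\big)^p. \] Let $\varphi := (1+\sqrt{5})/2$. Then for every positive integer $p$ there exists a real number $\lambda_p > 1$ such that \[ S_F^{(p)}(N) \asymp_p N^{(\log \lambda_p)/\log \varphi} \] as $N \to +\infty$.
   Context: The Fibonacci numbers here are $f_1 = 1$, $f_2 = 2$, $f_{n+2} = f_{n+1} + f_n$ (so the available summands are the distinct values $1,2,3,5,8,\dots$); $r_F(0)=1$ (empty sum). For functions $f,g$ on positive integers, $f(N) \asymp_p g(N)$ means $0 < \liminf_{N\to\infty} f(N)/g(N) \le \limsup_{N\to\infty} f(N)/g(N) < +\infty$, where these bounds may depend on $p$. *)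

theory Defs
  imports "HOL-Analysis.Analysis" "HOL-Number_Theory.Fib"
begin

text \<open>
  The sequence $1, 2, 3, 5, 8, \dots$ is the library's \<^const>\<open>fib\<close> shifted so that the value
  $1$ occurs only once: $f_n = \mathrm{fib}\,(n+1)$ for $n \ge 1$. Representations are counted as
  sets of values, so neither the order nor the index of a summand plays a role.
\<close>

definition fib_numbers :: "nat set" where
  "fib_numbers = {fib (n + 1) | n. n \<ge> 1}"

definition r_F :: "nat \<Rightarrow> nat" where
  "r_F n = card {A. A \<subseteq> fib_numbers \<and> finite A \<and> \<Sum>A = n}"

definition S_F :: "nat \<Rightarrow> nat \<Rightarrow> nat" where
  "S_F p N = (\<Sum>n<N. r_F n ^ p)"

definition golden_ratio :: real where
  "golden_ratio = (1 + sqrt 5) / 2"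

text \<open>
  The limits are taken in the extended reals, where they always exist. The value at $N = 0$ does
  not affect them.
\<close>

definition same_order :: "(nat \<Rightarrow> real) \<Rightarrow> (nat \<Rightarrow> real) \<Rightarrow> bool" (infix "\<asymp>" 50) where
  "f \<asymp> g \<longleftrightarrow>
     0 < liminf (\<lambda>N. ereal (f N / g N)) \<and>
     liminf (\<lambda>N. ereal (f N / g N)) \<le> limsup (\<lambda>N. ereal (f N / g N)) \<and>
     limsup (\<lambda>N. ereal (f N / g N)) < \<infinity>"

text \<open>
  The set counted by \<^const>\<open>r_F\<close> is finite, so its cardinality is the genuine one.
\<close>

lemma finite_representations:
  "finite {A. A \<subseteq> fib_numbers \<and> finite A \<and> \<Sum>A = n}"
proof (rule finite_subset)
  show "{A. A \<subseteq> fib_numbers \<and> finite A \<and> \<Sum>A = n} \<subseteq> Pow {..n}"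
    using member_le_sum[of _ _ "\<lambda>x::nat. x"] by fastforce
qed simp

lemma r_F_0: "r_F 0 = 1"
proof -
  have "{A. A \<subseteq> fib_numbers \<and> finite A \<and> \<Sum>A = 0} = {{}}"
  proof -
    have "x > 0" if "x \<in> fib_numbers" for x
      using that by (auto simp: fib_numbers_def intro!: fib_neq_0_nat)
    then show ?thesis by fastforce
  qed
  then show ?thesis by (simp add: r_F_def)
qed

end

theory Submission
  imports Defs
begin

text \<open>
  Let \<open>moment p m\<close> be the sum of the \<open>p\<close>-th powers of the numbers of representations that use only
  the first \<open>m\<close> summands. If two sets of indices represent the same number, so do the
  sets shifted by \<open>n\<close>, because the contributions of the conjugate root differ by less than one;
  moreover, distinct numbers move at least \<open>fib (n + 1)\<close> apart under the shift. Cutting a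
  representation over \<open>m + n\<close> indices into its \<open>n\<close> low and its \<open>m\<close> high ones therefore writes the
  number of representations as a sum of at most three products, so that \<open>moment p (m + n)\<close> lies
  between \<open>moment p m * moment p n\<close> and \<open>3 ^ p\<close> times it. Such a sequence is within a constant
  factor of \<open>lam ^ m\<close> for some \<open>lam\<close>, and \<open>lam \<ge> moment p 1 = 2\<close>. Finally, \<open>S_F p N\<close> is sandwiched
  between moments whose index is \<open>log N / log golden_ratio\<close> up to a bounded error.
\<close>

section \<open>Growth of quasi-multiplicative sequences\<close>

text \<open>A Fekete-type argument. Iterating both inequalities bounds \<open>a (m * n)\<close> from
  two sides, so every \<open>root m (a m)\<close> is at most every \<open>root n (C * a n)\<close>.
  The supremum of the former roots serves as \<open>lam\<close>.\<close>

lemma quasi_multiplicative_growth: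
  fixes a :: "nat \<Rightarrow> real" and C :: real
  assumes pos: "\<And>n. a n > 0" and C: "C > 0"
    and super: "\<And>m n. a m * a n \<le> a (m + n)"
    and sub: "\<And>m n. a (m + n) \<le> C * (a m * a n)"
  shows "\<exists>lam \<ge> a 1. \<forall>n. a n \<le> lam ^ n \<and> lam ^ n \<le> C * a n"
proof -
  have upper: "a (m * n) \<le> (C * a n) ^ m" if "m > 0" for m n
    using that
  proof (induction m rule: nat_induct_non_zero)
    case 1
    \<comment> \<open>The instances at index 0 yield \<open>1 \<le> C\<close>, which is what this
      base case amounts to.\<close>
    have "a n * a 0 \<le> a n" using super[of n 0] by simp
    moreover have "a n \<le> a n * (C * a 0)" using sub[of n 0] by (simp add: mult_ac)
    ultimately have "a 0 \<le> 1" "1 \<le> C * a 0" using pos[of n] by simp_all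
    moreover have "C * a 0 \<le> C" using \<open>a 0 \<le> 1\<close> C by simp
    ultimately show ?case using pos[of n] by simp
  next
    case (Suc m)
    have "a (Suc m * n) \<le> C * a n * a (m * n)" using sub[of n "m * n"] by (simp add: mult_ac)
    also have "\<dots> \<le> C * a n * (C * a n) ^ m"
      using Suc.IH pos[of n] C by (intro mult_left_mono) auto
    finally show ?case by simp
  qed
  have lower: "a m ^ n \<le> a (m * n)" if "n > 0" for m n
    using that
  proof (induction n rule: nat_induct_non_zero)
    case (Suc n)
    have "a m ^ Suc n \<le> a m * a (m * n)" using Suc.IH pos[of m] by simp
    also have "\<dots> \<le> a (m * Suc n)" using super[of m "m * n"] by simp
    finally show ?case .
  qed simp
  define R where "R = (\<lambda>m. root m (a m)) ` {1..}"
  have root_le: "root m (a m) \<le> root n (C * a n)" if "m > 0" "n > 0" for m n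
  proof -
    \<comment> \<open>Raising both sides to the power \<open>m * n\<close> reduces the claim to the
      two bounds on \<open>a (m * n)\<close>.\<close>
    have "(root m (a m) ^ n) ^ m = a m ^ n"
      using that pos[of m] by (simp flip: power_mult add: mult.commute[of n]) (simp add: power_mult)
    also have "\<dots> \<le> a (m * n)" using lower that by simp
    also have "\<dots> \<le> (C * a n) ^ m" using upper that by simp
    finally have "root m (a m) ^ n \<le> C * a n"
      using power_le_imp_le_base[of "root m (a m) ^ n" "m - 1"] that pos[of n] C by simp
    also have "\<dots> = root n (C * a n) ^ n" using that pos[of n] C by simp
    finally show ?thesis
      using power_le_imp_le_base[of "root m (a m)" "n - 1"] that pos[of n] C by simp
  qed
  have "bdd_above R"
    using root_le[of _ 1] by (intro bdd_aboveI[of _ "C * a 1"]) (auto simp: R_def Suc_le_eq)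
  define lam where "lam = Sup R"
  have root_le_lam: "root n (a n) \<le> lam" if "n > 0" for n
    unfolding lam_def using that \<open>bdd_above R\<close> by (intro cSup_upper) (auto simp: R_def)
  have "a n \<le> lam ^ n \<and> lam ^ n \<le> C * a n" for n
  proof (cases "n = 0")
    case True
    have "a 0 \<le> 1" "1 \<le> C * a 0" using super[of 0 0] sub[of 0 0] pos[of 0] by simp_all
    with True show ?thesis by simp
  next
    case False
    have "0 \<le> root n (a n)" using pos[of n] False by simp
    then have "root n (a n) ^ n \<le> lam ^ n" "0 \<le> lam"
      using root_le_lam[of n] False by (blast intro: power_mono order.trans)+
    moreover have "lam \<le> root n (C * a n)"
      unfolding lam_def using False root_le by (intro cSup_least) (auto simp: R_def)
    then have "lam ^ n \<le> root n (C * a n) ^ n" using \<open>0 \<le> lam\<close> by (intro power_mono)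
    ultimately show ?thesis using False pos[of n] C by simp
  qed
  moreover have "a 1 \<le> lam" using root_le_lam[of 1] by simp
  ultimately show ?thesis by blast
qed

section \<open>Sums of powers against powers of sums\<close>

lemma sum_power_le_power_sum:
  fixes f :: "'a \<Rightarrow> nat"
  assumes "finite P" "p \<ge> 1"
  shows "(\<Sum>x\<in>P. f x ^ p) \<le> (\<Sum>x\<in>P. f x) ^ p"
proof -
  have "(\<Sum>x\<in>P. f x ^ p) = (\<Sum>x\<in>P. f x * f x ^ (p - 1))"
    using assms by (simp flip: power_Suc)
  also have "\<dots> \<le> (\<Sum>x\<in>P. f x * (\<Sum>x\<in>P. f x) ^ (p - 1))"
    using assms by (intro sum_mono mult_left_mono power_mono member_le_sum) auto
  also have "\<dots> = (\<Sum>x\<in>P. f x) ^ p"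
    using assms by (simp flip: sum_distrib_right power_Suc)
  finally show ?thesis .
qed

text \<open>The sum is at most \<open>k\<close> times its largest term, and the \<open>p\<close>-th
  power of that term already occurs on the right.\<close>

lemma power_sum_le_card_power_sum:
  fixes f :: "'a \<Rightarrow> nat"
  assumes "finite P" "card P \<le> k" "p \<ge> 1"
  shows "(\<Sum>x\<in>P. f x) ^ p \<le> k ^ p * (\<Sum>x\<in>P. f x ^ p)"
proof (cases "P = {}")
  case True
  with assms show ?thesis by simp
next
  case False
  then obtain y where y: "y \<in> P" "f y = Max (f ` P)"
    using Max_in[of "f ` P"] assms(1) by fastforce
  have "(\<Sum>x\<in>P. f x) \<le> card P * f y"
    using sum_bounded_above[of P f "f y"] assms(1) y by simp
  also have "\<dots> \<le> k * f y" using assms by simp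
  finally have "(\<Sum>x\<in>P. f x) ^ p \<le> k ^ p * f y ^ p"
    by (simp add: power_mono flip: power_mult_distrib)
  also have "\<dots> \<le> k ^ p * (\<Sum>x\<in>P. f x ^ p)"
    using y assms by (intro mult_left_mono member_le_sum) auto
  finally show ?thesis .
qed

section \<open>Fibonacci numbers and the golden ratio\<close>

definition golden_conj :: real where
  "golden_conj = (1 - sqrt 5) / 2"

lemma golden_ratio_square: "golden_ratio ^ 2 = golden_ratio + 1"
  by (simp add: golden_ratio_def power2_eq_square field_simps)

lemma golden_ratio_bounds: "3 / 2 < golden_ratio" "golden_ratio < 2"
proof -
  have "2 < sqrt 5" "sqrt 5 < 3" by (auto intro: real_less_rsqrt real_less_lsqrt)
  then show "3 / 2 < golden_ratio" "golden_ratio < 2" by (auto simp: golden_ratio_def)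
qed

lemma golden_conj_conv: "golden_conj = 1 - golden_ratio"
  by (simp add: golden_conj_def golden_ratio_def field_simps)

lemma golden_conj_square: "golden_conj ^ 2 = golden_conj + 1"
  by (simp add: golden_conj_def power2_eq_square field_simps)

text \<open>The error made by replacing an index shift with multiplication by
  \<open>golden_ratio\<close> is multiplied by \<open>golden_conj\<close> at each step, since the
  two roots have product -1.\<close>

lemma fib_Suc_minus_golden: "real (fib (Suc n)) - golden_ratio * real (fib n) = golden_conj ^ n"
proof (induction n)
  case (Suc n)
  have "golden_conj * golden_ratio = -1"
    using golden_ratio_square by (simp add: golden_conj_conv power2_eq_square algebra_simps)
  have "real (fib (Suc (Suc n))) - golden_ratio * real (fib (Suc n)) =
      golden_conj * real (fib (Suc n)) + real (fib n)"
    by (simp add: golden_conj_conv algebra_simps)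
  also have "\<dots> = golden_conj * (real (fib (Suc n)) - golden_ratio * real (fib n))"
    using \<open>golden_conj * golden_ratio = -1\<close> by (simp add: algebra_simps flip: mult.assoc)
  finally show ?case using Suc by simp
qed simp

lemma fib_golden_bounds:
  "golden_ratio ^ n \<le> real (fib (n + 2))" "real (fib (n + 2)) \<le> golden_ratio ^ (n + 1)"
proof -
  have *: "golden_ratio ^ (k + 2) = golden_ratio ^ (k + 1) + golden_ratio ^ k" for k
    unfolding power_add golden_ratio_square by (simp add: algebra_simps)
  show "golden_ratio ^ n \<le> real (fib (n + 2))"
  proof (induction n rule: fib.induct)
    case (3 n)
    then show ?case using *[of n] by simp
  qed (use golden_ratio_bounds in auto)
  show "real (fib (n + 2)) \<le> golden_ratio ^ (n + 1)"
  proof (induction n rule: fib.induct)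
    case (3 n)
    then show ?case using *[of "n + 1"] by simp
  qed (use golden_ratio_bounds golden_ratio_square in \<open>auto simp: power2_eq_square\<close>)
qed

lemma fib_increasing: "strict_mono (\<lambda>i. fib (i + 2))"
  by (simp add: strict_mono_Suc_iff fib_neq_0_nat)

lemma less_fib: "n < fib (n + 3)"
  using strict_mono_imp_increasing[OF fib_increasing, of "n + 1"] by (simp add: numeral_eq_Suc)

section \<open>Fibonacci sums under index shifts\<close>

text \<open>Index 0 stands for the summand 1, as \<open>fib 2 = 1\<close>; thus each summand has
  exactly one index. The argument \<open>n\<close> raises all indices at once.\<close>

definition fib_sum :: "nat \<Rightarrow> nat set \<Rightarrow> nat" where
  "fib_sum n B = (\<Sum>i\<in>B. fib (i + 2 + n))"

text \<open>The addition formula for \<open>fib\<close> reduces all shifts to the shifts by 0 and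
  1.\<close>

lemma fib_sum_Suc: "fib_sum (Suc n) B = fib n * fib_sum 0 B + fib (Suc n) * fib_sum 1 B"
proof -
  have "fib (i + 2 + Suc n) = fib n * fib (i + 2 + 0) + fib (Suc n) * fib (i + 2 + 1)" for i
    using fib_add[of "i + 2" n] by (simp add: add_ac numeral_eq_Suc)
  then show ?thesis
    unfolding fib_sum_def by (simp only: sum.distrib sum_distrib_left)
qed

text \<open>With \<open>q ^ 2 = 1 - q\<close> the terms are \<open>q ^ i - q ^ (i + 1)\<close> and
  telescope; the full series has sum 1, so a finite part stays strictly below.\<close>

lemma sum_golden_conj_less:
  assumes "finite B"
  shows "(\<Sum>i\<in>B. \<bar>golden_conj\<bar> ^ (i + 2)) < 1"
proof -
  define q where "q = \<bar>golden_conj\<bar>"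
  have q: "q > 0" "q ^ 2 = 1 - q"
    using golden_conj_square golden_ratio_bounds
    by (auto simp: q_def golden_conj_conv power2_eq_square algebra_simps)
  have geo: "(\<Sum>i<M. q ^ (i + 2)) = 1 - q ^ M" for M
  proof (induction M)
    case (Suc M)
    have "q ^ (M + 2) = q ^ M - q ^ Suc M" unfolding power_add q(2) by (simp add: algebra_simps)
    then show ?case unfolding sum.lessThan_Suc Suc by simp
  qed (use q in simp)
  obtain M where "B \<subseteq> {..<M}" using assms finite_nat_iff_bounded by blast
  then have "(\<Sum>i\<in>B. q ^ (i + 2)) \<le> (\<Sum>i<M. q ^ (i + 2))"
    using q by (intro sum_mono2) auto
  also have "\<dots> < 1" using geo[of M] q by simp
  finally show ?thesis by (simp add: q_def)
qed

lemma fib_sum_1_eq: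
  "real (fib_sum 1 B) = golden_ratio * real (fib_sum 0 B) + (\<Sum>i\<in>B. golden_conj ^ (i + 2))"
proof -
  have "real (fib (i + 2 + 1)) = golden_ratio * real (fib (i + 2)) + golden_conj ^ (i + 2)" for i
    using fib_Suc_minus_golden[of "i + 2"] by simp
  then show ?thesis
    unfolding fib_sum_def of_nat_sum by (simp only: sum.distrib sum_distrib_left add_0_right)
qed

lemma fib_sum_1_gap:
  assumes "finite B" "finite B'" "fib_sum 0 B \<le> fib_sum 0 B'"
  shows "fib_sum 1 B + (fib_sum 0 B' - fib_sum 0 B) \<le> fib_sum 1 B'"
proof -
  let ?e = "\<lambda>B. \<Sum>i\<in>B. golden_conj ^ (i + 2)"
  \<comment> \<open>Common indices cancel. The remaining ones form two disjoint sets, so a single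
    application of the bound 1 covers both error sums.\<close>
  have "?e B - ?e B' = ?e (B - B') - ?e (B' - B)"
    using assms(1,2) sum.Int_Diff[of B "\<lambda>i. golden_conj ^ (i + 2)" B']
      sum.Int_Diff[of B' "\<lambda>i. golden_conj ^ (i + 2)" B] by (simp add: Int_commute)
  also have "\<dots> \<le> \<bar>?e (B - B')\<bar> + \<bar>?e (B' - B)\<bar>" by linarith
  also have "\<dots> \<le> (\<Sum>i\<in>B - B'. \<bar>golden_conj\<bar> ^ (i + 2)) + (\<Sum>i\<in>B' - B. \<bar>golden_conj\<bar> ^ (i + 2))"
    by (intro add_mono order.trans[OF sum_abs] eq_refl sum.cong refl) (simp_all only: power_abs)
  also have "\<dots> = (\<Sum>i\<in>(B - B') \<union> (B' - B). \<bar>golden_conj\<bar> ^ (i + 2))"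
    using assms(1,2) by (intro sum.union_disjoint[symmetric]) auto
  also have "\<dots> < 1" using assms(1,2) by (intro sum_golden_conj_less) auto
  finally have e: "?e B - ?e B' < 1" .
  define d where "d = fib_sum 0 B' - fib_sum 0 B"
  have "real (fib_sum 0 B') = real (fib_sum 0 B) + real d" using assms(3) by (simp add: d_def)
  then have "real (fib_sum 1 B') - real (fib_sum 1 B) = golden_ratio * real d - (?e B - ?e B')"
    unfolding fib_sum_1_eq by (simp add: algebra_simps)
  moreover have "real d \<le> golden_ratio * real d"
    using golden_ratio_bounds by (intro mult_le_cancel_right1[THEN iffD2]) auto
  ultimately have "real (fib_sum 1 B) + real d < real (fib_sum 1 B') + 1" using e by linarith
  \<comment> \<open>Both sides are integers, so the strict bound with slack 1 gives the non-strict
    one.\<close>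
  then show ?thesis unfolding d_def by linarith
qed

text \<open>For \<open>n = Suc k\<close>, a gap \<open>d\<close> contributes
  \<open>fib k * d\<close> through shift 0 and at least \<open>fib (Suc k) * d\<close> through shift
  1, together \<open>fib (Suc n) * d\<close>.\<close>

lemma fib_sum_gap:
  assumes "finite B" "finite B'" "fib_sum 0 B \<le> fib_sum 0 B'"
  shows "fib_sum n B + fib (Suc n) * (fib_sum 0 B' - fib_sum 0 B) \<le> fib_sum n B'"
proof (cases n)
  case 0
  then show ?thesis using assms by simp
next
  case (Suc k)
  define d where "d = fib_sum 0 B' - fib_sum 0 B"
  have d: "fib_sum 0 B' = fib_sum 0 B + d" using assms by (simp add: d_def)
  have "fib (Suc k) * (fib_sum 1 B + d) \<le> fib (Suc k) * fib_sum 1 B'"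
    using fib_sum_1_gap[OF assms] by (simp add: d_def)
  then have "fib_sum n B + fib (Suc n) * d \<le> fib_sum n B'"
    unfolding Suc fib_sum_Suc d by (simp add: algebra_simps)
  then show ?thesis by (simp add: d_def)
qed

lemma fib_sum_cong:
  assumes "finite B" "finite B'" "fib_sum 0 B = fib_sum 0 B'"
  shows "fib_sum n B = fib_sum n B'"
  using fib_sum_gap[of B B' n] fib_sum_gap[of B' B n] assms by simp

lemma fib_sum_less:
  assumes "B \<subseteq> {..<m}"
  shows "fib_sum 0 B < fib (m + 3)"
proof -
  have "(\<Sum>i<m. fib (i + 2)) + 2 = fib (m + 3)"
    by (induction m) (simp_all add: numeral_eq_Suc)
  moreover have "fib_sum 0 B \<le> (\<Sum>i<m. fib (i + 2))"
    unfolding fib_sum_def using assms by (auto intro: sum_mono2)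
  ultimately show ?thesis by simp
qed

section \<open>Truncated representation counts and their moments\<close>

definition fib_sums :: "nat \<Rightarrow> nat set" where
  "fib_sums m = fib_sum 0 ` Pow {..<m}"

definition rep :: "nat \<Rightarrow> nat \<Rightarrow> nat" where
  "rep m N = card {B. B \<subseteq> {..<m} \<and> fib_sum 0 B = N}"

definition moment :: "nat \<Rightarrow> nat \<Rightarrow> nat" where
  "moment p m = (\<Sum>N\<in>fib_sums m. rep m N ^ p)"

lemma finite_fib_sums: "finite (fib_sums m)"
  by (simp add: fib_sums_def)

lemma fib_sums_less: "a \<in> fib_sums m \<Longrightarrow> a < fib (m + 3)"
  by (auto simp: fib_sums_def intro: fib_sum_less)

lemma finite_rep: "finite {B. B \<subseteq> {..<m::nat} \<and> fib_sum 0 B = N}"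
  by (rule finite_subset[of _ "Pow {..<m}"]) auto

lemma rep_pos_iff: "rep m N > 0 \<longleftrightarrow> N \<in> fib_sums m"
  using finite_rep[of m N] by (auto simp: rep_def card_gt_0_iff fib_sums_def)

text \<open>The additional terms are \<open>0 ^ p\<close>, which vanishes because
  \<open>p \<ge> 1\<close>.\<close>

lemma moment_eq_sum:
  assumes "finite X" "fib_sums m \<subseteq> X" "p \<ge> 1"
  shows "moment p m = (\<Sum>N\<in>X. rep m N ^ p)"
  unfolding moment_def
proof (rule sum.mono_neutral_left)
  show "\<forall>N\<in>X - fib_sums m. rep m N ^ p = 0" using rep_pos_iff assms(3) by fastforce
qed (use assms in auto)

text \<open>
  The shift of all indices by \<open>n\<close>, as a function of the represented number; by \<open>fib_sum_cong\<close> it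
  does not depend on the representation. Junk outside \<open>fib_sums m\<close>.
\<close>

definition shift :: "nat \<Rightarrow> nat \<Rightarrow> nat \<Rightarrow> nat" where
  "shift m n a = fib_sum n (SOME B. B \<subseteq> {..<m} \<and> fib_sum 0 B = a)"

lemma shift_fib_sum:
  assumes "B \<subseteq> {..<m}"
  shows "shift m n (fib_sum 0 B) = fib_sum n B"
proof -
  let ?B = "SOME B'. B' \<subseteq> {..<m} \<and> fib_sum 0 B' = fib_sum 0 B"
  have "?B \<subseteq> {..<m} \<and> fib_sum 0 ?B = fib_sum 0 B" by (rule someI[of _ B]) (use assms in simp)
  then show ?thesis
    unfolding shift_def using assms finite_subset[OF _ finite_lessThan[of m]]
    by (intro fib_sum_cong[of ?B B n]) blast+
qed

lemma shift_gap:
  assumes "a \<in> fib_sums m" "a' \<in> fib_sums m" "a \<le> a'"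
  shows "shift m n a + fib (Suc n) * (a' - a) \<le> shift m n a'"
proof -
  obtain B B' where "B \<subseteq> {..<m}" "a = fib_sum 0 B" "B' \<subseteq> {..<m}" "a' = fib_sum 0 B'"
    using assms by (auto simp: fib_sums_def)
  then show ?thesis
    using assms(3) fib_sum_gap[of B B' n] by (simp add: shift_fib_sum finite_subset[OF _ finite_lessThan])
qed

lemma fib_sum_append:
  assumes "L \<subseteq> {..<n}" "finite H"
  shows "fib_sum 0 (L \<union> (\<lambda>i. i + n) ` H) = fib_sum n H + fib_sum 0 L"
proof -
  have "fib_sum 0 (L \<union> (\<lambda>i. i + n) ` H) = fib_sum 0 L + fib_sum 0 ((\<lambda>i. i + n) ` H)"
    unfolding fib_sum_def using assms
    by (intro sum.union_disjoint) (auto intro: finite_subset)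
  also have "fib_sum 0 ((\<lambda>i. i + n) ` H) = fib_sum n H"
    unfolding fib_sum_def by (subst sum.reindex) (auto simp: add_ac)
  finally show ?thesis by simp
qed

section \<open>Splitting representations into high and low indices\<close>

text \<open>The first component is the value of the high part before its shift by \<open>n\<close>.
  Only values are recorded, so many representations can share a pair.\<close>

definition high_low_pairs :: "nat \<Rightarrow> nat \<Rightarrow> nat \<Rightarrow> (nat \<times> nat) set" where
  "high_low_pairs m n N = {x \<in> fib_sums m \<times> fib_sums n. shift m n (fst x) + snd x = N}"

lemma finite_high_low_pairs: "finite (high_low_pairs m n N)"
  by (simp add: high_low_pairs_def finite_fib_sums)

text \<open>Cutting at index \<open>n\<close> is a bijection; once the two values are fixed, the
  high and the low index sets can be chosen independently.\<close>

lemma rep_add: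
  "rep (m + n) N = (\<Sum>x\<in>high_low_pairs m n N. rep m (fst x) * rep n (snd x))"
proof -
  let ?R = "\<lambda>m N. {B. B \<subseteq> {..<m} \<and> fib_sum 0 B = N}"
  let ?S = "SIGMA x:high_low_pairs m n N. ?R m (fst x) \<times> ?R n (snd x)"
  let ?f = "\<lambda>(x::nat\<times>nat, H, L). L \<union> (\<lambda>i. i + n) ` H"
  let ?hi = "\<lambda>B. {i. i + n \<in> B}" and ?lo = "\<lambda>B. B \<inter> {..<n}"
  let ?g = "\<lambda>B. ((fib_sum 0 (?hi B), fib_sum 0 (?lo B)), ?hi B, ?lo B)"
  have join: "?lo B \<union> (\<lambda>i. i + n) ` ?hi B = B" for B
  proof -
    have "x \<in> (\<lambda>i. i + n) ` ?hi B" if "x \<in> B" "\<not> x < n" for x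
      using that by (intro image_eqI[of _ _ "x - n"]) auto
    then show ?thesis by auto
  qed
  have "bij_betw ?f ?S (?R (m + n) N)"
  proof (rule bij_betw_byWitness[where f' = ?g])
    show "\<forall>y\<in>?S. ?g (?f y) = y"
    proof
      fix y assume "y \<in> ?S"
      then obtain a c H L where y: "y = ((a, c), H, L)"
        and *: "L \<subseteq> {..<n}" "fib_sum 0 H = a" "fib_sum 0 L = c"
        by (cases y) auto
      have "?hi (L \<union> (\<lambda>i. i + n) ` H) = H" "?lo (L \<union> (\<lambda>i. i + n) ` H) = L" using *(1) by auto
      then show "?g (?f y) = y" by (simp only: y prod.case *(2,3))
    qed
    show "\<forall>B\<in>?R (m + n) N. ?f (?g B) = B" by (simp only: prod.case join) simp
    show "?f ` ?S \<subseteq> ?R (m + n) N"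
    proof clarify
      fix a c H L
      assume *: "(a, c) \<in> high_low_pairs m n N" "H \<subseteq> {..<m}" "L \<subseteq> {..<n}"
        "fib_sum 0 H = fst (a, c)" "fib_sum 0 L = snd (a, c)"
      have "fib_sum 0 (L \<union> (\<lambda>i. i + n) ` H) = fib_sum n H + fib_sum 0 L"
        using * by (intro fib_sum_append) (auto intro: finite_subset)
      also have "\<dots> = N"
        using * shift_fib_sum[of H m n] by (simp add: high_low_pairs_def)
      finally show "L \<union> (\<lambda>i. i + n) ` H \<subseteq> {..<m + n} \<and> fib_sum 0 (L \<union> (\<lambda>i. i + n) ` H) = N"
        using * by auto
    qed
    show "?g ` ?R (m + n) N \<subseteq> ?S"
    proof (rule image_subsetI)
      fix B assume B: "B \<in> ?R (m + n) N"
      then have hi: "?hi B \<subseteq> {..<m}" by auto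
      moreover have "finite (?hi B)" using hi by (rule finite_subset) simp
      then have "fib_sum 0 B = fib_sum n (?hi B) + fib_sum 0 (?lo B)"
        using fib_sum_append[of "?lo B" n "?hi B"] join[of B] by simp
      ultimately have "(fib_sum 0 (?hi B), fib_sum 0 (?lo B)) \<in> high_low_pairs m n N"
        using B shift_fib_sum[OF hi, of n] by (simp add: high_low_pairs_def fib_sums_def)
      then show "?g B \<in> ?S" using hi by simp
    qed
  qed
  then have "rep (m + n) N = card ?S" by (simp add: rep_def bij_betw_same_card)
  also have "\<dots> = (\<Sum>x\<in>high_low_pairs m n N. rep m (fst x) * rep n (snd x))"
    by (subst card_SigmaI) (auto simp: finite_high_low_pairs finite_rep card_cartesian_product rep_def)
  finally show ?thesis .
qed

text \<open>Raising the high value by \<open>d\<close> raises its shift by at least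
  \<open>fib (Suc n) * d\<close>, while the low value can only compensate less than
  \<open>fib (n + 3)\<close>, which is at most three such steps.\<close>

lemma card_high_low_pairs: "card (high_low_pairs m n N) \<le> 3"
proof (cases "high_low_pairs m n N = {}")
  case False
  let ?P = "high_low_pairs m n N"
  define a0 where "a0 = Min (fst ` ?P)"
  have "a0 \<in> fst ` ?P" unfolding a0_def using False by (intro Min_in) (auto simp: finite_high_low_pairs)
  then obtain c0 where 0: "(a0, c0) \<in> ?P" by force
  have "fst ` ?P \<subseteq> {a0..<a0 + 3}"
  proof clarify
    fix a c assume 1: "(a, c) \<in> ?P"
    have "a0 \<le> a" unfolding a0_def using 1 by (intro Min_le) (force simp: finite_high_low_pairs)+
    then have "shift m n a0 + fib (Suc n) * (a - a0) \<le> shift m n a"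
      using 0 1 by (intro shift_gap) (auto simp: high_low_pairs_def)
    \<comment> \<open>Both pairs have total \<open>N\<close>, so the shifted value can grow by at
      most \<open>c0\<close>.\<close>
    then have "fib (Suc n) * (a - a0) \<le> c0"
      using 0 1 by (simp add: high_low_pairs_def)
    also have "c0 < fib (n + 3)" using 0 by (auto simp: high_low_pairs_def intro: fib_sums_less)
    also have "\<dots> \<le> fib (Suc n) * 3" using fib_Suc_mono[of n] by (simp add: numeral_eq_Suc)
    finally have "a - a0 < 3" by simp
    with \<open>a0 \<le> a\<close> show "fst (a, c) \<in> {a0..<a0 + 3}" by simp
  qed
  then have "card (fst ` ?P) \<le> card {a0..<a0 + 3}" by (intro card_mono) auto
  \<comment> \<open>The low value is \<open>N\<close> minus the shifted high value.\<close>
  moreover have "inj_on fst ?P" by (auto simp: inj_on_def high_low_pairs_def)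
  ultimately show ?thesis by (simp add: card_image)
qed simp

text \<open>The sets \<open>high_low_pairs m n N\<close> are the fibres of one map on the product,
  whose values lie in \<open>fib_sums (m + n)\<close>.\<close>

lemma sum_high_low_pairs:
  fixes f :: "nat \<times> nat \<Rightarrow> nat"
  shows "(\<Sum>N\<in>fib_sums (m + n). \<Sum>x\<in>high_low_pairs m n N. f x) = (\<Sum>x\<in>fib_sums m \<times> fib_sums n. f x)"
  unfolding high_low_pairs_def
proof (rule sum.group)
  show "(\<lambda>x. shift m n (fst x) + snd x) ` (fib_sums m \<times> fib_sums n) \<subseteq> fib_sums (m + n)"
  proof clarify
    fix a c assume "a \<in> fib_sums m" "c \<in> fib_sums n"
    then obtain H L where *: "H \<subseteq> {..<m}" "a = fib_sum 0 H" "L \<subseteq> {..<n}" "c = fib_sum 0 L"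
      by (auto simp: fib_sums_def)
    then have "shift m n a + c = fib_sum 0 (L \<union> (\<lambda>i. i + n) ` H)"
      by (subst fib_sum_append) (auto simp: shift_fib_sum intro: finite_subset)
    moreover have "L \<union> (\<lambda>i. i + n) ` H \<in> Pow {..<m + n}" using * by auto
    ultimately show "shift m n (fst (a, c)) + snd (a, c) \<in> fib_sums (m + n)"
      unfolding fib_sums_def by simp
  qed
qed (simp_all add: finite_fib_sums)

lemma moment_mult:
  "moment p m * moment p n =
     (\<Sum>N\<in>fib_sums (m + n). \<Sum>x\<in>high_low_pairs m n N. (rep m (fst x) * rep n (snd x)) ^ p)"
  unfolding sum_high_low_pairs moment_def
  by (simp add: sum_product sum.cartesian_product power_mult_distrib case_prod_unfold)

lemma moment_supermult:
  assumes "p \<ge> 1"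
  shows "moment p m * moment p n \<le> moment p (m + n)"
  unfolding moment_mult unfolding moment_def[of p "m + n"] rep_add
  using assms by (intro sum_mono sum_power_le_power_sum finite_high_low_pairs)

lemma moment_submult:
  assumes "p \<ge> 1"
  shows "moment p (m + n) \<le> 3 ^ p * (moment p m * moment p n)"
proof -
  have "moment p (m + n) \<le> (\<Sum>N\<in>fib_sums (m + n).
      3 ^ p * (\<Sum>x\<in>high_low_pairs m n N. (rep m (fst x) * rep n (snd x)) ^ p))"
    unfolding moment_def rep_add using assms
    by (intro sum_mono power_sum_le_card_power_sum finite_high_low_pairs card_high_low_pairs)
  then show ?thesis unfolding moment_mult sum_distrib_left[of "3 ^ p", symmetric] .
qed

text \<open>This value keeps the growth rate away from 1.\<close>

lemma moment_1: "moment p 1 = 2"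
proof -
  have Pow: "Pow {..<1::nat} = {{}, {0}}" by (auto simp: lessThan_Suc Pow_insert)
  have "{B. B \<subseteq> {..<1} \<and> fib_sum 0 B = N} = {B \<in> {{}, {0}}. fib_sum 0 B = N}" for N
    unfolding Pow[symmetric] by blast
  moreover have "{B \<in> {{}, {0}}. fib_sum 0 B = 0} = {{}}" "{B \<in> {{}, {0}}. fib_sum 0 B = 1} = {{0}}"
    by (auto simp: fib_sum_def)
  ultimately have "rep 1 0 = 1" "rep 1 1 = 1" by (simp_all only: rep_def card_1_singleton_iff) auto
  moreover have "fib_sums 1 = {0, 1}" unfolding fib_sums_def Pow by (simp add: fib_sum_def)
  ultimately show ?thesis by (simp add: moment_def)
qed

lemma moment_pos: "moment p m > 0"
proof -
  have "fib_sum 0 {} \<in> fib_sums m" unfolding fib_sums_def by (intro imageI) simp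
  then show ?thesis unfolding moment_def by (intro sum_pos) (auto simp: finite_fib_sums rep_pos_iff)
qed

section \<open>Comparing \<open>S_F\<close> with the moments\<close>

text \<open>The map from \<open>i\<close> to \<open>fib (i + 2)\<close> is a bijection onto
  \<open>fib_numbers\<close>, so sets of values correspond to sets of indices.\<close>

lemma r_F_eq_card_index_sets: "r_F N = card {B. finite B \<and> fib_sum 0 B = N}"
proof -
  let ?h = "\<lambda>i::nat. fib (i + 2)"
  have inj: "inj ?h" using fib_increasing by (rule strict_mono_imp_inj_on)
  have range: "fib_numbers = range ?h"
  proof (rule set_eqI)
    fix x
    have "(\<exists>n\<ge>1. x = fib (n + 1)) \<longleftrightarrow> (\<exists>i. x = fib (i + 2))"
      by (metis Suc_eq_plus1 add_2_eq_Suc' le_add2 le_Suc_ex plus_1_eq_Suc)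
    then show "x \<in> fib_numbers \<longleftrightarrow> x \<in> range ?h" by (auto simp: fib_numbers_def)
  qed
  have sum: "\<Sum>(?h ` B) = fib_sum 0 B" for B
    by (subst sum.reindex[OF inj_on_subset[OF inj subset_UNIV]]) (simp add: fib_sum_def)
  have "bij_betw ((`) ?h) {B. finite B \<and> fib_sum 0 B = N}
      {A. A \<subseteq> fib_numbers \<and> finite A \<and> \<Sum>A = N}"
    unfolding bij_betw_def
  proof
    show "inj_on ((`) ?h) {B. finite B \<and> fib_sum 0 B = N}"
      by (rule inj_onI) (use inj_image_eq_iff[OF inj] in blast)
    show "(`) ?h ` {B. finite B \<and> fib_sum 0 B = N} = {A. A \<subseteq> fib_numbers \<and> finite A \<and> \<Sum>A = N}"
    proof (intro equalityI subsetI)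
      fix A assume "A \<in> {A. A \<subseteq> fib_numbers \<and> finite A \<and> \<Sum>A = N}"
      then have A: "A \<subseteq> range ?h" "finite A" "\<Sum>A = N" by (auto simp: range)
      then obtain B where B: "finite B" "A = ?h ` B" by (metis finite_subset_image)
      with A(3) have "fib_sum 0 B = N" by (simp only: sum)
      with B show "A \<in> (`) ?h ` {B. finite B \<and> fib_sum 0 B = N}" by (intro image_eqI[of _ _ B]) auto
    next
      fix A assume "A \<in> (`) ?h ` {B. finite B \<and> fib_sum 0 B = N}"
      then obtain B where "A = ?h ` B" "finite B" "fib_sum 0 B = N" by blast
      then show "A \<in> {A. A \<subseteq> fib_numbers \<and> finite A \<and> \<Sum>A = N}"
        unfolding range by (simp only: sum mem_Collect_eq) blast
    qed
  qed
  then show ?thesis by (simp add: r_F_def bij_betw_same_card)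
qed

lemma index_less_of_fib_sum_less:
  assumes "finite B" "fib_sum 0 B < fib (m + 2)"
  shows "B \<subseteq> {..<m}"
proof
  fix i assume "i \<in> B"
  then have "fib (i + 2) \<le> fib_sum 0 B"
    using assms(1) member_le_sum[of i B "\<lambda>i. fib (i + 2)"] by (simp add: fib_sum_def)
  with assms(2) show "i \<in> {..<m}"
    using strict_mono_less[OF fib_increasing, of i m] by simp
qed

lemma finite_index_sets: "finite {B. finite B \<and> fib_sum 0 B = N}"
proof -
  have "{B. finite B \<and> fib_sum 0 B = N} \<subseteq> Pow {..<N + 1}"
    using index_less_of_fib_sum_less[of _ "N + 1"] less_fib[of N] by (auto simp: numeral_eq_Suc)
  then show ?thesis by (rule finite_subset) simp
qed

lemma rep_le_r_F: "rep m N \<le> r_F N"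
  unfolding rep_def r_F_eq_card_index_sets
  by (intro card_mono finite_index_sets) (auto intro: finite_subset)

lemma r_F_eq_rep:
  assumes "N < fib (m + 2)"
  shows "r_F N = rep m N"
  unfolding rep_def r_F_eq_card_index_sets
  using index_less_of_fib_sum_less[of _ m] assms
  by (intro arg_cong[of _ _ card]) (auto intro: finite_subset)

lemma S_F_mono: "M \<le> N \<Longrightarrow> S_F p M \<le> S_F p N"
  unfolding S_F_def by (intro sum_mono2) auto

text \<open>All numbers represented with the first \<open>m\<close> indices lie below
  \<open>fib (m + 3)\<close>, and truncation can only lower the counts.\<close>

lemma moment_le_S_F:
  assumes "p \<ge> 1" "fib (m + 3) \<le> N"
  shows "moment p m \<le> S_F p N"
proof -
  have "moment p m = (\<Sum>N<fib (m + 3). rep m N ^ p)"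
    using assms by (intro moment_eq_sum) (auto intro: fib_sums_less)
  also have "\<dots> \<le> S_F p (fib (m + 3))"
    unfolding S_F_def by (intro sum_mono power_mono rep_le_r_F) auto
  also have "\<dots> \<le> S_F p N" using assms by (intro S_F_mono)
  finally show ?thesis .
qed

text \<open>Below \<open>fib (m + 2)\<close> no index from \<open>m\<close> on can occur, so
  truncation loses nothing there.\<close>

lemma S_F_le_moment:
  assumes "p \<ge> 1" "N \<le> fib (m + 2)"
  shows "S_F p N \<le> moment p m"
proof -
  have "S_F p N \<le> S_F p (fib (m + 2))" using assms by (intro S_F_mono)
  also have "\<dots> = (\<Sum>N<fib (m + 2). rep m N ^ p)"
    unfolding S_F_def by (intro sum.cong) (auto simp: r_F_eq_rep)
  also have "\<dots> \<le> (\<Sum>N\<in>{..<fib (m + 2)} \<union> fib_sums m. rep m N ^ p)"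
    by (intro sum_mono2) (auto simp: finite_fib_sums)
  also have "\<dots> = moment p m"
    using assms by (intro moment_eq_sum[symmetric]) (auto simp: finite_fib_sums)
  finally show ?thesis .
qed

section \<open>Asymptotic order of \<open>S_F\<close>\<close>

lemma same_orderI:
  assumes "c > 0" and "eventually (\<lambda>N. c \<le> f N / g N \<and> f N / g N \<le> D) sequentially"
  shows "f \<asymp> g"
proof -
  have "ereal c \<le> liminf (\<lambda>N. ereal (f N / g N))"
    using assms(2) by (intro Liminf_bounded) (auto elim: eventually_mono)
  moreover have "limsup (\<lambda>N. ereal (f N / g N)) \<le> ereal D"
    using assms(2) by (intro Limsup_bounded) (auto elim: eventually_mono)
  moreover have "liminf (\<lambda>N. ereal (f N / g N)) \<le> limsup (\<lambda>N. ereal (f N / g N))"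
    by (intro Liminf_le_Limsup) simp
  ultimately show ?thesis
    unfolding same_order_def using assms(1)
    by (meson ereal_less(2) less_ereal.simps(4) order_less_le_trans order_le_less_trans)
qed

lemma fib_bracket:
  assumes "N \<ge> 2"
  shows "\<exists>k. fib (k + 3) \<le> N \<and> N < fib (k + 4)"
proof -
  define n where "n = (LEAST n. N < fib (n + 3))"
  have "N < fib (n + 3)" unfolding n_def by (rule LeastI[of _ N, OF less_fib])
  \<comment> \<open>The least index is not 0 because \<open>fib 3 = 2 \<le> N\<close>.\<close>
  then obtain k where k: "n = Suc k" using assms by (cases n) (auto simp: numeral_eq_Suc)
  then have "\<not> N < fib (k + 3)" unfolding n_def by (intro not_less_Least) auto
  with \<open>N < fib (n + 3)\<close> k show ?thesis by (intro exI[of _ k]) (simp add: numeral_eq_Suc)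
qed

theorem theorem1:
  fixes p :: nat
  assumes "p \<ge> 1"
  shows "\<exists>lam::real. lam > 1 \<and>
           (\<lambda>N. real (S_F p N)) \<asymp> (\<lambda>N. real N powr (ln lam / ln golden_ratio))"
proof -
  have "real (moment p m) * real (moment p n) \<le> real (moment p (m + n))" for m n
    using moment_supermult[OF assms, of m n] by (simp flip: of_nat_mult)
  moreover have "real (moment p (m + n)) \<le> 3 ^ p * (real (moment p m) * real (moment p n))" for m n
    using of_nat_mono[OF moment_submult[OF assms, of m n], where 'a = real] by simp
  ultimately obtain lam :: real where "lam \<ge> real (moment p 1)"
    and lam: "\<And>n. real (moment p n) \<le> lam ^ n" "\<And>n. lam ^ n \<le> 3 ^ p * real (moment p n)"
    using quasi_multiplicative_growth[of "\<lambda>n. real (moment p n)" "3 ^ p"] moment_pos by auto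
  then have "lam \<ge> 2" by (simp add: moment_1 del: One_nat_def)
  \<comment> \<open>This exponent turns powers of \<open>golden_ratio\<close> into powers of
    \<open>lam\<close>.\<close>
  define e where "e = ln lam / ln golden_ratio"
  have "ln golden_ratio > 0" using golden_ratio_bounds by simp
  then have "e \<ge> 0" using \<open>lam \<ge> 2\<close> by (simp add: e_def)
  have pow: "(golden_ratio ^ n) powr e = lam ^ n" for n
  proof -
    have "golden_ratio powr e = lam"
      using golden_ratio_bounds \<open>lam \<ge> 2\<close> by (simp add: powr_def e_def)
    moreover have "(golden_ratio ^ n) powr e = (golden_ratio powr e) ^ n"
      using golden_ratio_bounds by (simp add: powr_realpow[symmetric] powr_powr mult.commute powr_power)
    ultimately show ?thesis by simp
  qed
  \<comment> \<open>For the bracketing \<open>k\<close>, \<open>real N powr e\<close> lies between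
    \<open>lam ^ (k + 1)\<close> and \<open>lam ^ (k + 3)\<close>, and \<open>S_F p N\<close>
    between \<open>lam ^ k / 3 ^ p\<close> and \<open>lam ^ (k + 2)\<close>; the constants are the
    extreme quotients.\<close>
  have "1 / (3 ^ p * lam ^ 3) \<le> real (S_F p N) / real N powr e \<and>
      real (S_F p N) / real N powr e \<le> lam" if "N \<ge> 2" for N
  proof -
    obtain k where k: "fib (k + 3) \<le> N" "N < fib (k + 4)" using fib_bracket[OF \<open>N \<ge> 2\<close>] by blast
    have "golden_ratio ^ (k + 1) \<le> real N"
      using fib_golden_bounds(1)[of "k + 1"] k(1) by (simp add: numeral_eq_Suc)
    then have "(golden_ratio ^ (k + 1)) powr e \<le> real N powr e"
      using \<open>e \<ge> 0\<close> golden_ratio_bounds by (intro powr_mono2) auto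
    then have N1: "lam ^ (k + 1) \<le> real N powr e" by (simp only: pow)
    have "real N \<le> golden_ratio ^ (k + 3)"
      using fib_golden_bounds(2)[of "k + 2"] k(2) by (simp add: numeral_eq_Suc)
    then have "real N powr e \<le> (golden_ratio ^ (k + 3)) powr e"
      using \<open>e \<ge> 0\<close> by (intro powr_mono2) auto
    then have N2: "real N powr e \<le> lam ^ (k + 3)" by (simp only: pow)
    have S1: "lam ^ k \<le> 3 ^ p * real (S_F p N)"
      using lam(2)[of k] moment_le_S_F[OF assms k(1)]
      by (meson mult_left_mono of_nat_mono order_trans zero_le_numeral zero_le_power)
    have "real N powr e \<le> lam ^ 3 * lam ^ k" using N2 by (simp add: power_add mult.commute)
    also have "\<dots> \<le> lam ^ 3 * (3 ^ p * real (S_F p N))"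
      using S1 \<open>lam \<ge> 2\<close> by (intro mult_left_mono) auto
    finally have upper: "real N powr e \<le> lam ^ 3 * (3 ^ p * real (S_F p N))" .
    have "S_F p N \<le> moment p (k + 2)"
      using S_F_le_moment[OF assms, of N "k + 2"] k(2) by (simp add: numeral_eq_Suc)
    then have "real (S_F p N) \<le> lam ^ (k + 2)"
      using lam(1)[of "k + 2"] by (meson of_nat_mono order_trans)
    also have "\<dots> = lam * lam ^ (k + 1)" by simp
    also have "\<dots> \<le> lam * real N powr e" using N1 \<open>lam \<ge> 2\<close> by (intro mult_left_mono) auto
    finally have "real (S_F p N) \<le> lam * real N powr e" .
    moreover have "real N powr e > 0" using \<open>N \<ge> 2\<close> by simp
    ultimately show ?thesis using upper \<open>lam \<ge> 2\<close> by (simp add: field_simps)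
  qed
  then have "(\<lambda>N. real (S_F p N)) \<asymp> (\<lambda>N. real N powr e)"
    using \<open>lam \<ge> 2\<close>
    by (intro same_orderI[of "1 / (3 ^ p * lam ^ 3)" _ _ lam])
      (auto intro!: eventually_mono[OF eventually_ge_at_top[of "2::nat"]])
  with \<open>lam \<ge> 2\<close> show ?thesis unfolding e_def by (intro exI[of _ lam]) simp
qed

end
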